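(* Let $p\in(1,\infty)$. For every $n\in\mathbb{N}=\{1,2,\ldots\}$ let $\boldsymbol{\sigma}=\boldsymbol{\sigma}^{(n)}=(\sigma_1,\ldots,\sigma_n)\in\{0,1\}^n$ be given, let $a_n=\#\{j\in\{1,\ldots,n\} : \sigma_j=0\}$ be the number of zero components of $\boldsymbol{\sigma}^{(n)}$, and put $N=2^n$. Then the two-dimensional digit shifted Hammersley point sets $\mathcal{R}_{n,\boldsymbol{\sigma}}$ satisfy $$L_{p,N}(\mathcal{R}_{n,\boldsymbol{\sigma}})\ll_p \frac{\sqrt{\log N}}{N}$$ if and only if $$|2a_n-n|\ll_p\sqrt{n}.$$ That is: there exists a constant $C>0$, independent of $n$, such that $L_{p,2^n}(\mathcal{R}_{n,\boldsymbol{\sigma}^{(n)}})\le C\,\frac{\sqrt{\log (2^n)}}{2^n}$ for all $n\in\mathbb{N}$, if and only if there exists a constant $C'>0$, independent of $n$, such that $|2a_n-n|\le C'\sqrt{n}$ for all $n\in\mathbb{N}$.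
   Context: For a finite set (or multiset) $\mathcal{P}=\{\boldsymbol{x}_0,\ldots,\boldsymbol{x}_{N-1}\}$ of $N$ points in $[0,1)^2$, the local discrepancy is $$D_N(\mathcal{P},\boldsymbol{t})=\frac{A_N([\boldsymbol{0},\boldsymbol{t}),\mathcal{P})}{N}-t_1t_2,\qquad \boldsymbol{t}=(t_1,t_2)\in[0,1]^2,$$ where $A_N([\boldsymbol{0},\boldsymbol{t}),\mathcal{P})$ is the number of indices $k$ with $\boldsymbol{x}_k\in[\boldsymbol{0},\boldsymbol{t}):=[0,t_1)\times[0,t_2)$. The $L_p$-discrepancy is $$L_{p,N}(\mathcal{P})=\left(\int_{[0,1]^2}|D_N(\mathcal{P},\boldsymbol{t})|^p\,\mathrm{d}\boldsymbol{t}\right)^{1/p}.$$ For $\boldsymbol{\sigma}=(\sigma_1,\ldots,\sigma_n)\in\{0,1\}^n$ the two-dimensional digit shifted Hammersley point set is $$\mathcal{R}_{n,\boldsymbol{\sigma}}=\Big\{\Big(\frac{t_n}{2}+\frac{t_{n-1}}{2^2}+\cdots+\frac{t_1}{2^n},\ \frac{t_1\oplus\sigma_1}{2}+\frac{t_2\oplus\sigma_2}{2^2}+\cdots+\frac{t_n\oplus\sigma_n}{2^n}\Big) : t_1,\ldots,t_n\in\{0,1\}\Big\},$$ where $t\oplus\sigma=t+\sigma \pmod 2$. It has $N=2^n$ elements. $\log$ is the natural logarithm. The notation $g\ll_p f$ means $g\le Cf$ for some constant $C>0$ which may depend on $p$ but not on $n$ (equivalently, not on $N$). *)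

theory Defs
  imports "HOL-Analysis.Analysis" "HOL-Library.Multiset" "HOL-Library.FuncSet"
begin

text \<open>The number \<open>N\<close> of points is the size of the multiset, so repeated points are
  counted with multiplicity, both in \<open>A\<^sub>N\<close> and in \<open>N\<close>.\<close>

definition local_discrepancy :: "(real \<times> real) multiset \<Rightarrow> real \<times> real \<Rightarrow> real" where
  "local_discrepancy P t =
     real (size {# x \<in># P. x \<in> {0..<fst t} \<times> {0..<snd t} #}) / real (size P) - fst t * snd t"

definition Lp_discrepancy :: "real \<Rightarrow> (real \<times> real) multiset \<Rightarrow> real" where
  "Lp_discrepancy p P =
     (LINT t:{0..1} \<times> {0..1}|lborel. \<bar>local_discrepancy P t\<bar> powr p) powr (1 / p)"

text \<open>Digit vectors are functions on the index set \<open>{1..n}\<close>; only the values of \<open>\<sigma>\<close>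
  on \<open>{1..n}\<close> are used.\<close>

definition hammersley_point :: "nat \<Rightarrow> (nat \<Rightarrow> nat) \<Rightarrow> (nat \<Rightarrow> nat) \<Rightarrow> real \<times> real" where
  "hammersley_point n \<sigma> t =
     (\<Sum>j=1..n. real (t j) / 2 ^ (n + 1 - j),
      \<Sum>j=1..n. real ((t j + \<sigma> j) mod 2) / 2 ^ j)"

definition shifted_hammersley :: "nat \<Rightarrow> (nat \<Rightarrow> nat) \<Rightarrow> (real \<times> real) set" where
  "shifted_hammersley n \<sigma> = hammersley_point n \<sigma> ` ({1..n} \<rightarrow>\<^sub>E {0, 1})"

definition num_zeros :: "nat \<Rightarrow> (nat \<Rightarrow> nat) \<Rightarrow> nat" where
  "num_zeros n \<sigma> = card {j \<in> {1..n}. \<sigma> j = 0}"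

lemma binary_digits_less:
  fixes t :: "nat \<Rightarrow> nat"
  assumes "\<And>j. j \<in> {1..n} \<Longrightarrow> t j \<le> 1"
  shows "(\<Sum>j=1..n. t j * 2 ^ (j - 1)) < 2 ^ n"
  using assms
proof (induction n)
  case (Suc n)
  have "t (Suc n) * 2 ^ n \<le> 1 * 2 ^ n"
    using Suc.prems by (intro mult_right_mono) auto
  then have "t (Suc n) * 2 ^ n \<le> 2 ^ n" by simp
  moreover have "(\<Sum>j=1..n. t j * 2 ^ (j - 1)) < 2 ^ n"
    using Suc.prems by (intro Suc.IH) auto
  ultimately have "(\<Sum>j=1..n. t j * 2 ^ (j - 1)) + t (Suc n) * 2 ^ n < 2 ^ n + 2 ^ n"
    by linarith
  then show ?case by simp
qed simp

lemma binary_digits_unique: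
  fixes s t :: "nat \<Rightarrow> nat"
  assumes "\<And>j. j \<in> {1..n} \<Longrightarrow> s j \<le> 1" "\<And>j. j \<in> {1..n} \<Longrightarrow> t j \<le> 1"
    and "(\<Sum>j=1..n. s j * 2 ^ (j - 1)) = (\<Sum>j=1..n. t j * 2 ^ (j - 1))"
  shows "\<forall>j\<in>{1..n}. s j = t j"
  using assms
proof (induction n)
  case (Suc n)
  define a where "a = (\<Sum>j=1..n. s j * 2 ^ (j - 1))"
  define b where "b = (\<Sum>j=1..n. t j * 2 ^ (j - 1))"
  have less: "a < 2 ^ n" "b < 2 ^ n"
    unfolding a_def b_def by (intro binary_digits_less; use Suc.prems in auto)+
  have eq: "a + s (Suc n) * 2 ^ n = b + t (Suc n) * 2 ^ n"
    using Suc.prems(3) by (simp add: a_def b_def)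
  have "(a + s (Suc n) * 2 ^ n) div 2 ^ n = (b + t (Suc n) * 2 ^ n) div 2 ^ n"
    by (simp only: eq)
  then have last: "s (Suc n) = t (Suc n)"
    using less by simp
  with eq have "a = b" by simp
  then have "\<forall>j\<in>{1..n}. s j = t j"
    using Suc.prems by (intro Suc.IH) (auto simp: a_def b_def)
  with last show ?case by (auto simp: le_Suc_eq)
qed simp

lemma fst_hammersley_point:
  "fst (hammersley_point n \<sigma> t) = real (\<Sum>j=1..n. t j * 2 ^ (j - 1)) / 2 ^ n"
proof -
  have "real (t j) / 2 ^ (n + 1 - j) = real (t j * 2 ^ (j - 1)) / 2 ^ n" if "j \<in> {1..n}" for j
  proof -
    have "(2::real) ^ n = 2 ^ (n + 1 - j) * 2 ^ (j - 1)"
      using that by (simp flip: power_add)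
    then show ?thesis by simp
  qed
  then show ?thesis
    by (simp add: hammersley_point_def sum_divide_distrib)
qed

lemma card_shifted_hammersley: "card (shifted_hammersley n \<sigma>) = 2 ^ n"
proof -
  have "inj_on (hammersley_point n \<sigma>) ({1..n} \<rightarrow>\<^sub>E {0, 1})"
  proof (rule inj_onI)
    fix s t
    assume s: "s \<in> {1..n} \<rightarrow>\<^sub>E {0, 1}" and t: "t \<in> {1..n} \<rightarrow>\<^sub>E {0, 1}"
      and eq: "hammersley_point n \<sigma> s = hammersley_point n \<sigma> t"
    have le: "s j \<le> 1" "t j \<le> 1" if "j \<in> {1..n}" for j
      using PiE_mem[OF s that] PiE_mem[OF t that] by auto
    have "real (\<Sum>j=1..n. s j * 2 ^ (j - 1)) = real (\<Sum>j=1..n. t j * 2 ^ (j - 1))"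
      using arg_cong[OF eq, of fst] unfolding fst_hammersley_point by simp
    then have "\<forall>j\<in>{1..n}. s j = t j"
      by (intro binary_digits_unique le) (simp_all only: of_nat_eq_iff)
    then show "s = t"
      using s t by (intro PiE_ext) auto
  qed
  then show ?thesis
    by (simp add: shifted_hammersley_def card_image card_PiE numeral_2_eq_2)
qed

end

theory Submission
  imports Defs
begin

text \<open>
  Write \<open>F\<^sub>n(x, k)\<close> for the number of points in \<open>[0, x) \<times> [0, k/2\<^sup>n)\<close> minus \<open>x k\<close>. Splitting off
  the digit \<open>t\<^sub>n\<close>, which is the first digit of one coordinate and the last digit of the other, gives
  \<open>F\<^sub>n(x, 2l) = F\<^sub>n\<^sub>-\<^sub>1(2x mod 1, l)\<close> and
  \<open>F\<^sub>n(x, 2l + 1) = F\<^sub>n\<^sub>-\<^sub>1(2x mod 1, l') + (-1)\<^bsup>\<sigma>\<^sub>n\<^esup> \<parallel>x\<parallel>\<close>, where \<open>l'\<close> is \<open>l\<close> or \<open>l + 1\<close> depending only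
  on \<open>\<sigma>\<^sub>n\<close> and the first digit of \<open>x\<close>, and \<open>\<parallel>x\<parallel>\<close> is the distance to the nearest integer. Summing
  over \<open>k\<close> makes the parity of \<open>k\<close> act as a fair coin independent of everything else, so the
  increments behave like independent bounded variables with means \<open>(-1)\<^bsup>\<sigma>\<^sub>j\<^esup> / 8\<close>. This yields a
  subgaussian bound for the exponential moments of \<open>N D\<^sub>N\<close>, hence for all \<open>L\<^sub>p\<close> norms, once
  \<open>\<bar>2a\<^sub>n - n\<bar> = O(\<surd>n)\<close>. Conversely, the integral of \<open>N D\<^sub>N\<close> equals \<open>(2a\<^sub>n - n) / 8 + O(1)\<close>, and its
  absolute value is at most the \<open>L\<^sub>1\<close> norm.
\<close>

subsection \<open>Splitting off the last digit\<close>

abbreviation digit_vectors :: "nat \<Rightarrow> (nat \<Rightarrow> nat) set" where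
  "digit_vectors n \<equiv> {1..n} \<rightarrow>\<^sub>E {0, 1}"

definition digit_sign :: "nat \<Rightarrow> real" where
  "digit_sign s = (if s = 0 then 1 else -1)"

lemma sum_digit_vectors_Suc:
  fixes f :: "(nat \<Rightarrow> nat) \<Rightarrow> 'a::comm_monoid_add"
  shows "(\<Sum>t\<in>digit_vectors (Suc n). f t)
    = (\<Sum>t\<in>digit_vectors n. f (t(Suc n := 0))) + (\<Sum>t\<in>digit_vectors n. f (t(Suc n := 1)))"
proof -
  have ins: "{1..Suc n} = insert (Suc n) {1..n}"
    by auto
  have inj: "inj_on (\<lambda>(y, g). g(Suc n := y)) ({0, 1::nat} \<times> digit_vectors n)"
    by (rule inj_combinator) simp
  show ?thesis
    unfolding ins PiE_insert_eq sum.reindex[OF inj]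
    by (simp add: sum.cartesian_product' comp_def)
qed

lemma finite_digit_vectors: "finite (digit_vectors n)"
  by (intro finite_PiE) auto

lemma card_digit_vectors: "card (digit_vectors n) = 2 ^ n"
  by (simp add: card_PiE numeral_2_eq_2)

lemma fst_hammersley_point_Suc:
  "fst (hammersley_point (Suc n) \<sigma> (t(Suc n := b))) = (real b + fst (hammersley_point n \<sigma> t)) / 2"
  by (simp add: hammersley_point_def sum_divide_distrib add_divide_distrib Suc_diff_le mult.commute)

lemma snd_hammersley_point_Suc:
  "snd (hammersley_point (Suc n) \<sigma> (t(Suc n := b)))
    = snd (hammersley_point n \<sigma> t) + real ((b + \<sigma> (Suc n)) mod 2) / 2 ^ Suc n"
  by (simp add: hammersley_point_def)

text \<open>Numerator of the second coordinate over the denominator 2 ^ n. Keeping it a natural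
  number lets the parity of a threshold \<open>k\<close> interact with the last binary
  digit.\<close>

definition second_rank :: "nat \<Rightarrow> (nat \<Rightarrow> nat) \<Rightarrow> (nat \<Rightarrow> nat) \<Rightarrow> nat" where
  "second_rank n \<sigma> t = (\<Sum>j=1..n. ((t j + \<sigma> j) mod 2) * 2 ^ (n - j))"

lemma snd_hammersley_point: "snd (hammersley_point n \<sigma> t) = real (second_rank n \<sigma> t) / 2 ^ n"
proof -
  have "real ((t j + \<sigma> j) mod 2) / 2 ^ j = real ((t j + \<sigma> j) mod 2 * 2 ^ (n - j)) / 2 ^ n"
    if "j \<in> {1..n}" for j
  proof -
    have "(2::real) ^ n = 2 ^ j * 2 ^ (n - j)"
      using that by (simp flip: power_add)
    then show ?thesis by simp
  qed
  then show ?thesis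
    by (simp add: hammersley_point_def second_rank_def sum_divide_distrib)
qed

lemma second_rank_Suc:
  "second_rank (Suc n) \<sigma> (t(Suc n := b)) = 2 * second_rank n \<sigma> t + (b + \<sigma> (Suc n)) mod 2"
  by (simp add: second_rank_def sum_distrib_left Suc_diff_le mult.left_commute)

text \<open>The first threshold ranges over all reals because the recursion passes on both
  \<open>2 * x\<close> and \<open>2 * x - 1\<close>. One of them is always at most 0 or at least 1,
  where the count is explicit.\<close>

definition box_count :: "nat \<Rightarrow> (nat \<Rightarrow> nat) \<Rightarrow> real \<Rightarrow> nat \<Rightarrow> real" where
  "box_count n \<sigma> x k = (\<Sum>t\<in>digit_vectors n.
     of_bool (fst (hammersley_point n \<sigma> t) < x \<and> second_rank n \<sigma> t < k))"

lemma box_count_0: "box_count 0 \<sigma> x k = of_bool (0 < x \<and> 0 < k)"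
  by (simp add: box_count_def hammersley_point_def second_rank_def)

lemma box_count_Suc:
  "box_count (Suc n) \<sigma> x k
    = box_count n \<sigma> (2 * x) ((k + 1 - \<sigma> (Suc n) mod 2) div 2)
    + box_count n \<sigma> (2 * x - 1) ((k + 1 - (1 + \<sigma> (Suc n)) mod 2) div 2)"
proof -
  \<comment> \<open>The right side is the ceiling of (k - s) / 2. Adding 1 before subtracting
    \<open>s\<close> keeps the natural subtraction from truncating.\<close>
  have *: "2 * v + s < k \<longleftrightarrow> v < (k + 1 - s) div 2" if "s < 2" for v s :: nat
    using that by (cases s) auto
  have "2 * v + (b + \<sigma> (Suc n)) mod 2 < k \<longleftrightarrow> v < (k + 1 - (b + \<sigma> (Suc n)) mod 2) div 2" for b v
    by (rule *) simp
  moreover have "(real b + u) / 2 < x \<longleftrightarrow> u < 2 * x - real b" for b and u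
    by auto
  ultimately show ?thesis
    unfolding box_count_def sum_digit_vectors_Suc
    by (simp only: fst_hammersley_point_Suc second_rank_Suc) simp
qed

lemma box_count_even:
  "box_count (Suc n) \<sigma> x (2 * l) = box_count n \<sigma> (2 * x) l + box_count n \<sigma> (2 * x - 1) l"
proof -
  have "(2 * l + 1 - s) div 2 = l" if "s < 2" for s
    using that by (cases s) auto
  then show ?thesis
    by (simp add: box_count_Suc del: mod_less_divisor)
qed

text \<open>Compared with \<open>2 * l\<close>, the threshold admits the extra rank
  \<open>2 * l\<close>, whose last digit is 0. That digit vanishes exactly when the new digit equals
  \<open>\<sigma> (Suc n)\<close>, so only this half receives \<open>l + 1\<close>; the other
  receives \<open>l\<close>.\<close>

lemma box_count_odd:
  assumes "\<sigma> (Suc n) \<in> {0, 1}"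
  shows "box_count (Suc n) \<sigma> x (2 * l + 1)
    = box_count n \<sigma> (2 * x) (l + 1 - \<sigma> (Suc n)) + box_count n \<sigma> (2 * x - 1) (l + \<sigma> (Suc n))"
  using assms by (auto simp: box_count_Suc)

lemma box_count_nonpos: "x \<le> 0 \<Longrightarrow> box_count n \<sigma> x k = 0"
proof (induction n arbitrary: x k)
  case 0
  then show ?case by (simp add: box_count_0)
next
  case (Suc n)
  then show ?case by (simp add: box_count_Suc)
qed

text \<open>Every first coordinate is below 1, so only the second condition counts, and the ranks
  run once through 0, ..., 2 ^ n - 1. The induction obtains this directly from the
  recursion.\<close>

lemma box_count_ge_1:
  assumes "\<forall>j\<in>{1..n}. \<sigma> j \<in> {0, 1}" "1 \<le> x" "k \<le> 2 ^ n"
  shows "box_count n \<sigma> x k = real k"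
  using assms
proof (induction n arbitrary: x k)
  case 0
  then show ?case by (cases k) (auto simp: box_count_0)
next
  case (Suc n)
  have IH: "box_count n \<sigma> z l = real l" if "1 \<le> z" "l \<le> 2 ^ n" for z l
    using that Suc.prems(1) by (intro Suc.IH) auto
  have s: "\<sigma> (Suc n) \<in> {0, 1}"
    using Suc.prems(1) by auto
  show ?case
  proof (cases "even k")
    case True
    then obtain l where "k = 2 * l" by blast
    then show ?thesis
      using Suc.prems by (simp add: box_count_even IH)
  next
    case False
    then obtain l where k: "k = 2 * l + 1" by (rule oddE)
    then have "l < 2 ^ n"
      using Suc.prems by simp
    then show ?thesis
      using Suc.prems(2) s unfolding k box_count_odd[of \<sigma> n, OF s] by (auto simp: IH)
  qed
qed

text \<open>This is \<open>F\<^sub>n\<close>: the local discrepancy at (x, k / 2 ^ n), multiplied by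
  2 ^ n.\<close>

definition grid_discr :: "nat \<Rightarrow> (nat \<Rightarrow> nat) \<Rightarrow> real \<Rightarrow> nat \<Rightarrow> real" where
  "grid_discr n \<sigma> x k = box_count n \<sigma> x k - x * real k"

lemma grid_discr_0: "grid_discr 0 \<sigma> x k = of_bool (0 < x \<and> 0 < k) - x * real k"
  by (simp add: grid_discr_def box_count_0)

section \<open>Recursion for the discrepancy on the left and right halves\<close>

context
  fixes n :: nat and \<sigma> :: "nat \<Rightarrow> nat"
  assumes digits: "\<forall>j\<in>{1..Suc n}. \<sigma> j \<in> {0, 1}"
begin

lemma grid_discr_even_left:
  "x \<le> 1 / 2 \<Longrightarrow> grid_discr (Suc n) \<sigma> x (2 * l) = grid_discr n \<sigma> (2 * x) l"
  by (simp add: grid_discr_def box_count_even box_count_nonpos)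

lemma grid_discr_even_right:
  "1 / 2 \<le> x \<Longrightarrow> l \<le> 2 ^ n \<Longrightarrow> grid_discr (Suc n) \<sigma> x (2 * l) = grid_discr n \<sigma> (2 * x - 1) l"
  unfolding grid_discr_def box_count_even using digits by (simp add: box_count_ge_1) (simp add: algebra_simps)

text \<open>The right half contributes no points. Since x * (2 * l + 1) differs from the area term 2
  * x * (l + 1 - s) of the left half by x * (1 - 2 * s), with s the last shift digit, a signed
  multiple of \<open>x\<close> remains.\<close>

lemma grid_discr_odd_left:
  assumes "x \<le> 1 / 2"
  shows "grid_discr (Suc n) \<sigma> x (2 * l + 1)
    = grid_discr n \<sigma> (2 * x) (l + 1 - \<sigma> (Suc n)) + digit_sign (\<sigma> (Suc n)) * x"
proof -
  have s: "\<sigma> (Suc n) \<in> {0, 1}"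
    using digits by auto
  then show ?thesis
    using assms unfolding grid_discr_def box_count_odd[of \<sigma> n, OF s]
    by (auto simp: box_count_nonpos digit_sign_def algebra_simps)
qed

text \<open>The left half is now counted completely. The bound \<open>l < 2 ^ n\<close> keeps its
  threshold, which can be \<open>l + 1\<close>, within the range of
  \<open>box_count_ge_1\<close>.\<close>

lemma grid_discr_odd_right:
  assumes "1 / 2 \<le> x" "l < 2 ^ n"
  shows "grid_discr (Suc n) \<sigma> x (2 * l + 1)
    = grid_discr n \<sigma> (2 * x - 1) (l + \<sigma> (Suc n)) + digit_sign (\<sigma> (Suc n)) * (1 - x)"
proof -
  have s: "\<sigma> (Suc n) \<in> {0, 1}"
    using digits by auto
  have "box_count n \<sigma> (2 * x) (l + 1 - \<sigma> (Suc n)) = real (l + 1 - \<sigma> (Suc n))"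
    using digits assms by (intro box_count_ge_1) auto
  then show ?thesis
    using s unfolding grid_discr_def box_count_odd[of \<sigma> n, OF s]
    by (auto simp: digit_sign_def algebra_simps)
qed

end

subsection \<open>Exponential moments on the grid\<close>

lemma sum_even_odd:
  fixes f :: "nat \<Rightarrow> 'a::comm_monoid_add"
  shows "(\<Sum>k\<le>2 * m. f k) = (\<Sum>l\<le>m. f (2 * l)) + (\<Sum>l<m. f (2 * l + 1))"
  by (induction m) (simp_all add: add_ac)

text \<open>An unnormalised exponential moment. The value k = 2 ^ n is included because
  \<open>k\<close> will be the ceiling of 2 ^ n * y for y in [0, 1].\<close>

definition grid_mgf :: "nat \<Rightarrow> (nat \<Rightarrow> nat) \<Rightarrow> real \<Rightarrow> real \<Rightarrow> real" where
  "grid_mgf n \<sigma> \<theta> x = (\<Sum>k\<le>2 ^ n. exp (\<theta> * grid_discr n \<sigma> x k))"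

lemma grid_mgf_nonneg: "0 \<le> grid_mgf n \<sigma> \<theta> x"
  by (simp add: grid_mgf_def sum_nonneg)

text \<open>The term k = 0 contributes 1, and k = 1 contributes at most \<open>exp 1\<close>, hence
  at most 3.\<close>

lemma grid_mgf_0_le:
  assumes "0 \<le> x" "x \<le> 1" "\<bar>\<theta>\<bar> \<le> 1"
  shows "grid_mgf 0 \<sigma> \<theta> x \<le> 4"
proof -
  have "\<theta> * (of_bool (0 < x) - x) \<le> \<bar>\<theta>\<bar> * \<bar>of_bool (0 < x) - x\<bar>"
    by (metis abs_ge_self abs_mult)
  also have "\<dots> \<le> 1 * 1"
    using assms by (intro mult_mono) auto
  finally have "exp (\<theta> * (of_bool (0 < x) - x)) \<le> exp 1"
    by simp
  also have "\<dots> \<le> (3::real)"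
    by (rule exp_le)
  finally show ?thesis
    by (simp add: grid_mgf_def grid_discr_0)
qed

text \<open>Both rounding directions of an odd \<open>k\<close> give sums over subsets of \<open>{..2 ^ n}\<close>; an upper bound
  does not notice which one is missing.\<close>
lemma grid_mgf_step:
  assumes "\<And>l. l \<le> 2 ^ n \<Longrightarrow> grid_discr (Suc n) \<sigma> x (2 * l) = grid_discr n \<sigma> z l"
    and "\<And>l. l < 2 ^ n \<Longrightarrow> grid_discr (Suc n) \<sigma> x (2 * l + 1) = grid_discr n \<sigma> z (l + s) + d"
    and "s \<in> {0, 1}"
  shows "grid_mgf (Suc n) \<sigma> \<theta> x \<le> (1 + exp (\<theta> * d)) * grid_mgf n \<sigma> \<theta> z"
proof -
  let ?f = "\<lambda>k. exp (\<theta> * grid_discr n \<sigma> z k)"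
  have "grid_mgf (Suc n) \<sigma> \<theta> x
      = (\<Sum>l\<le>2 ^ n. exp (\<theta> * grid_discr (Suc n) \<sigma> x (2 * l)))
        + (\<Sum>l<2 ^ n. exp (\<theta> * grid_discr (Suc n) \<sigma> x (2 * l + 1)))"
    by (simp add: grid_mgf_def sum_even_odd)
  also have "\<dots> = grid_mgf n \<sigma> \<theta> z + exp (\<theta> * d) * (\<Sum>l<2 ^ n. ?f (l + s))"
    using assms(1,2)
    by (simp add: grid_mgf_def sum_distrib_left distrib_left exp_add mult.commute)
  also have "(\<Sum>l<2 ^ n. ?f (l + s)) = sum ?f ((\<lambda>l. l + s) ` {..<2 ^ n})"
    by (subst sum.reindex) (auto simp: inj_on_def)
  also have "\<dots> \<le> grid_mgf n \<sigma> \<theta> z"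
    unfolding grid_mgf_def using assms(3) by (intro sum_mono2) auto
  finally show ?thesis
    by (simp add: distrib_right)
qed

lemma grid_mgf_left:
  assumes "\<forall>j\<in>{1..Suc n}. \<sigma> j \<in> {0, 1}" "x \<le> 1 / 2"
  shows "grid_mgf (Suc n) \<sigma> \<theta> x
    \<le> (1 + exp (\<theta> * (digit_sign (\<sigma> (Suc n)) * x))) * grid_mgf n \<sigma> \<theta> (2 * x)"
proof (rule grid_mgf_step)
  have "\<sigma> (Suc n) \<le> 1"
    using assms(1) by force
  then show "grid_discr (Suc n) \<sigma> x (2 * l + 1)
      = grid_discr n \<sigma> (2 * x) (l + (1 - \<sigma> (Suc n))) + digit_sign (\<sigma> (Suc n)) * x" for l
    using assms by (simp only: grid_discr_odd_left) simp
qed (use assms in \<open>auto simp: grid_discr_even_left\<close>)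

lemma grid_mgf_right:
  assumes "\<forall>j\<in>{1..Suc n}. \<sigma> j \<in> {0, 1}" "1 / 2 \<le> x"
  shows "grid_mgf (Suc n) \<sigma> \<theta> x
    \<le> (1 + exp (\<theta> * (digit_sign (\<sigma> (Suc n)) * (1 - x)))) * grid_mgf n \<sigma> \<theta> (2 * x - 1)"
  using assms by (intro grid_mgf_step[where s = "\<sigma> (Suc n)"])
    (auto simp: grid_discr_even_right grid_discr_odd_right simp del: add_Suc_right One_nat_def)

section \<open>Estimate of the factor gained at one digit\<close>

lemma exp_le_quadratic:
  fixes z :: real
  assumes "\<bar>z\<bar> \<le> 1"
  shows "exp z \<le> 1 + z + z\<^sup>2"
proof (cases "0 \<le> z")
  case True
  then show ?thesis
    using assms exp_bound[of z] by simp
next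
  case False
  \<comment> \<open>For negative \<open>z\<close> the claim is compared after multiplication by 1 -
    z > 0: the left side is at most 1, the right side is 1 - z ^ 3.\<close>
  have "exp z * (1 - z) \<le> exp z * exp (- z)"
    using exp_ge_add_one_self[of "- z"] by (intro mult_left_mono) auto
  also have "\<dots> = 1"
    by (simp flip: exp_add)
  also have "\<dots> \<le> 1 - z * z\<^sup>2"
    using False by (simp add: mult_nonpos_nonneg)
  also have "\<dots> = (1 + z + z\<^sup>2) * (1 - z)"
    by (simp add: algebra_simps power2_eq_square)
  finally show ?thesis
    using False by (simp add: mult_le_cancel_right)
qed

text \<open>The points z / 2 and 1 / 2 + z / 2 have distances z / 2 and (1 - z) / 2 to the nearest
  integer. These add up to 1 / 2, so the linear terms no longer depend on \<open>z\<close>. Averaged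
  over two halves and two parities they give the mean 1 / 8, up to sign.\<close>

lemma mgf_factor_le:
  assumes "\<bar>\<theta>\<bar> \<le> 1" "0 \<le> z" "z \<le> 1"
  shows "2 + exp (\<theta> * (digit_sign s * (z / 2))) + exp (\<theta> * (digit_sign s * ((1 - z) / 2)))
    \<le> 4 * exp (\<theta> * digit_sign s / 8 + \<theta>\<^sup>2 / 4)"
proof -
  define a where "a = \<theta> * digit_sign s"
  have a: "\<bar>a\<bar> \<le> 1" "a\<^sup>2 = \<theta>\<^sup>2"
    using assms(1) by (auto simp: a_def digit_sign_def)
  have *: "exp (a * (u / 2)) \<le> 1 + a * u / 2 + \<theta>\<^sup>2 / 4" if "0 \<le> u" "u \<le> 1" for u
  proof -
    have "\<bar>a\<bar> * \<bar>u / 2\<bar> \<le> 1 * 1"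
      using a that by (intro mult_mono) auto
    then have "exp (a * (u / 2)) \<le> 1 + a * (u / 2) + (a * (u / 2))\<^sup>2"
      by (intro exp_le_quadratic) (simp add: abs_mult)
    moreover have "(a * (u / 2))\<^sup>2 \<le> \<theta>\<^sup>2 / 4"
      using that mult_left_mono[of "u\<^sup>2" 1 "\<theta>\<^sup>2"] by (simp add: power_mult_distrib power_divide a power_le_one)
    ultimately show ?thesis by simp
  qed
  have "2 + exp (a * (z / 2)) + exp (a * ((1 - z) / 2)) \<le> 4 * (1 + (a / 8 + \<theta>\<^sup>2 / 4))"
  proof -
    have "a * z / 2 + a * (1 - z) / 2 = a / 2"
      by (simp add: field_simps)
    moreover have "exp (a * (z / 2)) \<le> 1 + a * z / 2 + \<theta>\<^sup>2 / 4"
      using assms by (intro *)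
    moreover have "exp (a * ((1 - z) / 2)) \<le> 1 + a * (1 - z) / 2 + \<theta>\<^sup>2 / 4"
      using assms by (intro *) auto
    ultimately have "2 + exp (a * (z / 2)) + exp (a * ((1 - z) / 2)) \<le> 4 + a / 2 + \<theta>\<^sup>2 / 2"
      by linarith
    also have "\<dots> \<le> 4 * (1 + (a / 8 + \<theta>\<^sup>2 / 4))"
      by (simp add: distrib_left)
    finally show ?thesis .
  qed
  also have "\<dots> \<le> 4 * exp (a / 8 + \<theta>\<^sup>2 / 4)"
    by (intro mult_left_mono exp_ge_add_one_self) simp
  finally show ?thesis
    by (simp add: a_def mult.assoc)
qed


section \<open>Integration over the first coordinate by folding the unit interval\<close>

lemma measurable_grid_mgf [measurable]: "grid_mgf n \<sigma> \<theta> \<in> borel_measurable borel"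
  unfolding grid_mgf_def grid_discr_def box_count_def of_bool_def by measurable

text \<open>Substitution along the two inverse branches of the doubling map. The closed halves share
  the point 1 / 2, which is harmless for an upper bound.\<close>

lemma nn_integral_halves:
  fixes f :: "real \<Rightarrow> ennreal"
  assumes [measurable]: "f \<in> borel_measurable borel"
  shows "(\<integral>\<^sup>+x\<in>{0..1}. f x \<partial>lborel)
    \<le> ennreal (1 / 2) * (\<integral>\<^sup>+z\<in>{0..1}. (f (z / 2) + f (1 / 2 + z / 2)) \<partial>lborel)"
proof -
  have "(\<integral>\<^sup>+x\<in>{0..1}. f x \<partial>lborel)
      \<le> (\<integral>\<^sup>+x. f x * indicator {0..1 / 2} x + f x * indicator {1 / 2..1} x \<partial>lborel)"
    by (intro nn_integral_mono) (auto simp: indicator_def)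
  also have "\<dots> = (\<integral>\<^sup>+x\<in>{0..1 / 2}. f x \<partial>lborel) + (\<integral>\<^sup>+x\<in>{1 / 2..1}. f x \<partial>lborel)"
    by (intro nn_integral_add) auto
  also have "(\<integral>\<^sup>+x\<in>{0..1 / 2}. f x \<partial>lborel) = ennreal (1 / 2) * (\<integral>\<^sup>+z\<in>{0..1}. f (z / 2) \<partial>lborel)"
    by (subst nn_integral_real_affine[where c = "1 / 2" and t = 0])
      (auto simp: indicator_def intro!: arg_cong2[where f = "(*)"] nn_integral_cong)
  also have "(\<integral>\<^sup>+x\<in>{1 / 2..1}. f x \<partial>lborel) = ennreal (1 / 2) * (\<integral>\<^sup>+z\<in>{0..1}. f (1 / 2 + z / 2) \<partial>lborel)"
    by (subst nn_integral_real_affine[where c = "1 / 2" and t = "1 / 2"])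
      (auto simp: indicator_def intro!: arg_cong2[where f = "(*)"] nn_integral_cong)
  finally show ?thesis
    by (simp add: distrib_left distrib_right nn_integral_add)
qed

text \<open>Both preimages of \<open>z\<close> under doubling lead to
  \<open>grid_mgf n \<sigma> \<theta> z\<close>, so together they gain a factor
  \<open>4 * c\<close>. The 1 / 2 from the substitution leaves \<open>2 * c\<close> per digit: 2 for
  the doubled range of \<open>k\<close>, and \<open>c\<close> for drift and variance.\<close>

lemma nn_integral_grid_mgf_le:
  assumes "\<forall>j\<in>{1..n}. \<sigma> j \<in> {0, 1}" "\<bar>\<theta>\<bar> \<le> 1"
  shows "(\<integral>\<^sup>+x\<in>{0..1}. ennreal (grid_mgf n \<sigma> \<theta> x) \<partial>lborel)
    \<le> ennreal (4 * 2 ^ n * exp (\<theta> * (\<Sum>j=1..n. digit_sign (\<sigma> j)) / 8 + real n * \<theta>\<^sup>2 / 4))"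
  using assms(1)
proof (induction n)
  case 0
  have "(\<integral>\<^sup>+x\<in>{0..1}. ennreal (grid_mgf 0 \<sigma> \<theta> x) \<partial>lborel) \<le> (\<integral>\<^sup>+x\<in>{0..1::real}. ennreal 4 \<partial>lborel)"
    using grid_mgf_0_le[OF _ _ assms(2)]
    by (intro nn_integral_mono) (auto simp: indicator_def simp flip: ennreal_numeral intro!: ennreal_leI)
  then show ?case
    by (simp add: nn_integral_cmult_indicator)
next
  case (Suc n)
  define \<tau> where "\<tau> = digit_sign (\<sigma> (Suc n))"
  define c where "c = exp (\<theta> * \<tau> / 8 + \<theta>\<^sup>2 / 4)"
  have IH: "(\<integral>\<^sup>+x\<in>{0..1}. ennreal (grid_mgf n \<sigma> \<theta> x) \<partial>lborel)
    \<le> ennreal (4 * 2 ^ n * exp (\<theta> * (\<Sum>j=1..n. digit_sign (\<sigma> j)) / 8 + real n * \<theta>\<^sup>2 / 4))"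
    using Suc.prems by (intro Suc.IH) auto
  have step: "grid_mgf (Suc n) \<sigma> \<theta> (z / 2) + grid_mgf (Suc n) \<sigma> \<theta> (1 / 2 + z / 2)
      \<le> 4 * c * grid_mgf n \<sigma> \<theta> z" if "0 \<le> z" "z \<le> 1" for z
  proof -
    have "grid_mgf (Suc n) \<sigma> \<theta> (z / 2) + grid_mgf (Suc n) \<sigma> \<theta> (1 / 2 + z / 2)
      \<le> (1 + exp (\<theta> * (\<tau> * (z / 2)))) * grid_mgf n \<sigma> \<theta> z
        + (1 + exp (\<theta> * (\<tau> * ((1 - z) / 2)))) * grid_mgf n \<sigma> \<theta> z"
      using grid_mgf_left[OF Suc.prems, of "z / 2" \<theta>] grid_mgf_right[OF Suc.prems, of "1 / 2 + z / 2" \<theta>] that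
      unfolding \<tau>_def by (intro add_mono) (simp_all add: diff_divide_distrib)
    also have "\<dots> = (2 + exp (\<theta> * (\<tau> * (z / 2))) + exp (\<theta> * (\<tau> * ((1 - z) / 2)))) * grid_mgf n \<sigma> \<theta> z"
      by (simp add: algebra_simps)
    also have "\<dots> \<le> 4 * c * grid_mgf n \<sigma> \<theta> z"
      unfolding c_def \<tau>_def using assms(2) that
      by (intro mult_right_mono mgf_factor_le grid_mgf_nonneg)
    finally show ?thesis .
  qed
  have "(\<integral>\<^sup>+x\<in>{0..1}. ennreal (grid_mgf (Suc n) \<sigma> \<theta> x) \<partial>lborel)
      \<le> ennreal (1 / 2) * (\<integral>\<^sup>+z\<in>{0..1}. (ennreal (grid_mgf (Suc n) \<sigma> \<theta> (z / 2))
          + ennreal (grid_mgf (Suc n) \<sigma> \<theta> (1 / 2 + z / 2))) \<partial>lborel)"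
    by (rule nn_integral_halves) measurable
  also have "\<dots> \<le> ennreal (1 / 2) * (\<integral>\<^sup>+z\<in>{0..1}. (ennreal (4 * c) * ennreal (grid_mgf n \<sigma> \<theta> z)) \<partial>lborel)"
    using step
    by (intro mult_left_mono nn_integral_mono)
      (auto simp: indicator_def grid_mgf_nonneg c_def simp flip: ennreal_plus ennreal_mult intro!: ennreal_leI)
  also have "\<dots> = ennreal (1 / 2) * (ennreal (4 * c) * (\<integral>\<^sup>+z\<in>{0..1}. ennreal (grid_mgf n \<sigma> \<theta> z) \<partial>lborel))"
    by (simp add: mult.assoc nn_integral_cmult)
  also have "\<dots> \<le> ennreal (1 / 2) * (ennreal (4 * c) * ennreal (4 * 2 ^ n
      * exp (\<theta> * (\<Sum>j=1..n. digit_sign (\<sigma> j)) / 8 + real n * \<theta>\<^sup>2 / 4)))"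
    by (intro mult_left_mono IH) simp_all
  also have "ennreal (1 / 2) * (ennreal (4 * c) * ennreal (4 * 2 ^ n
      * exp (\<theta> * (\<Sum>j=1..n. digit_sign (\<sigma> j)) / 8 + real n * \<theta>\<^sup>2 / 4)))
    = ennreal (1 / 2 * (4 * c * (4 * 2 ^ n
      * exp (\<theta> * (\<Sum>j=1..n. digit_sign (\<sigma> j)) / 8 + real n * \<theta>\<^sup>2 / 4))))"
  proof -
    have "ennreal (1 / 2) * (ennreal a * ennreal b) = ennreal (1 / 2 * (a * b))"
      if "0 \<le> a" "0 \<le> b" for a b
      by (simp only: ennreal_mult''[OF mult_nonneg_nonneg[OF that]] ennreal_mult[OF that])
    then show ?thesis
      by this (simp_all add: c_def)
  qed
  also have "1 / 2 * (4 * c * (4 * 2 ^ n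
      * exp (\<theta> * (\<Sum>j=1..n. digit_sign (\<sigma> j)) / 8 + real n * \<theta>\<^sup>2 / 4)))
      = 4 * 2 ^ Suc n * exp (\<theta> * (\<Sum>j=1..Suc n. digit_sign (\<sigma> j)) / 8 + real (Suc n) * \<theta>\<^sup>2 / 4)"
  proof -
    have "exp (\<theta> * (\<Sum>j=1..Suc n. digit_sign (\<sigma> j)) / 8 + real (Suc n) * \<theta>\<^sup>2 / 4)
      = c * exp (\<theta> * (\<Sum>j=1..n. digit_sign (\<sigma> j)) / 8 + real n * \<theta>\<^sup>2 / 4)"
      unfolding c_def \<tau>_def exp_add[symmetric] by (simp add: field_simps)
    then show ?thesis by simp
  qed
  finally show ?case .
qed

subsection \<open>The local discrepancy scaled by \<open>N\<close>\<close>

lemma inj_on_hammersley_point: "inj_on (hammersley_point n \<sigma>) (digit_vectors n)"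
  using card_shifted_hammersley[of n \<sigma>] card_digit_vectors[of n] finite_digit_vectors[of n]
  by (intro eq_card_imp_inj_on) (simp_all add: shifted_hammersley_def)

lemma fst_hammersley_point_nonneg: "0 \<le> fst (hammersley_point n \<sigma> t)"
  and snd_hammersley_point_nonneg: "0 \<le> snd (hammersley_point n \<sigma> t)"
  by (simp_all add: hammersley_point_def sum_nonneg)

lemma fst_hammersley_point_less_1:
  assumes "t \<in> digit_vectors n"
  shows "fst (hammersley_point n \<sigma> t) < 1"
proof -
  have "(\<Sum>j=1..n. t j * 2 ^ (j - 1)) < 2 ^ n"
    using PiE_mem[OF assms] by (intro binary_digits_less) force
  then have "real (\<Sum>j=1..n. t j * 2 ^ (j - 1)) < 2 ^ n"
    by (metis of_nat_less_iff of_nat_numeral of_nat_power)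
  then show ?thesis
    unfolding fst_hammersley_point by simp
qed

lemma snd_hammersley_point_less_1: "snd (hammersley_point n \<sigma> t) < 1"
proof -
  \<comment> \<open>The strict bound by 1 is too weak for the induction; this sharper one absorbs
    the next digit.\<close>
  have "snd (hammersley_point n \<sigma> t) \<le> 1 - 1 / 2 ^ n"
  proof (induction n)
    case 0
    then show ?case by (simp add: hammersley_point_def)
  next
    case (Suc n)
    have "real ((t (Suc n) + \<sigma> (Suc n)) mod 2) / 2 ^ Suc n \<le> 1 / 2 ^ Suc n"
      by (intro divide_right_mono) auto
    then show ?case
      using Suc snd_hammersley_point_Suc[of n \<sigma> t "t (Suc n)"] by (simp add: field_simps)
  qed
  also have "\<dots> < 1"
    by simp
  finally show ?thesis .
qed

definition scaled_discr :: "nat \<Rightarrow> (nat \<Rightarrow> nat) \<Rightarrow> real \<times> real \<Rightarrow> real" where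
  "scaled_discr n \<sigma> z = 2 ^ n * local_discrepancy (mset_set (shifted_hammersley n \<sigma>)) z"

text \<open>Points are counted by their digit vectors, as the parametrisation is injective. The
  lower sides of the box disappear because the coordinates are nonnegative.\<close>

lemma scaled_discr_eq_sum:
  "scaled_discr n \<sigma> z = (\<Sum>t\<in>digit_vectors n.
      of_bool (fst (hammersley_point n \<sigma> t) < fst z \<and> snd (hammersley_point n \<sigma> t) < snd z))
    - 2 ^ n * (fst z * snd z)"
proof -
  let ?h = "hammersley_point n \<sigma>"
  let ?B = "{0..<fst z} \<times> {0..<snd z}"
  have image_filter: "{x \<in> f ` A. P x} = f ` {t \<in> A. P (f t)}"
    for f :: "(nat \<Rightarrow> nat) \<Rightarrow> real \<times> real" and A P
    by auto
  have fin: "finite (shifted_hammersley n \<sigma>)"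
    unfolding shifted_hammersley_def by (intro finite_imageI finite_digit_vectors)
  have "size {# x \<in># mset_set (shifted_hammersley n \<sigma>). x \<in> ?B #}
      = card {x \<in> shifted_hammersley n \<sigma>. x \<in> ?B}"
    by (simp add: fin)
  also have "{x \<in> shifted_hammersley n \<sigma>. x \<in> ?B} = ?h ` {t \<in> digit_vectors n. ?h t \<in> ?B}"
    unfolding shifted_hammersley_def by (rule image_filter)
  also have "card \<dots> = card {t \<in> digit_vectors n. ?h t \<in> ?B}"
    by (intro card_image inj_on_subset[OF inj_on_hammersley_point[of n \<sigma>]] Collect_subset)
  also have "{t \<in> digit_vectors n. ?h t \<in> ?B}
      = {t \<in> digit_vectors n. fst (?h t) < fst z \<and> snd (?h t) < snd z}"
    by (auto simp: mem_Times_iff fst_hammersley_point_nonneg snd_hammersley_point_nonneg)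
  finally have "real (size {# x \<in># mset_set (shifted_hammersley n \<sigma>). x \<in> ?B #})
      = (\<Sum>t\<in>digit_vectors n. of_bool (fst (?h t) < fst z \<and> snd (?h t) < snd z))"
    using finite_digit_vectors[of n] by (simp add: sum_of_bool_eq Int_def del: One_nat_def)
  then show ?thesis
    by (simp add: scaled_discr_def local_discrepancy_def card_shifted_hammersley right_diff_distrib fin)
qed

lemma measurable_scaled_discr [measurable]: "scaled_discr n \<sigma> \<in> borel_measurable borel"
proof -
  have [measurable]: "fst \<in> borel_measurable (borel :: (real \<times> real) measure)"
    "snd \<in> borel_measurable (borel :: (real \<times> real) measure)"
    by (intro borel_measurable_continuous_onI continuous_intros)+
  show ?thesis
    unfolding scaled_discr_eq_sum[abs_def] of_bool_def by measurable
qed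

lemma abs_scaled_discr_le:
  assumes "z \<in> {0..1} \<times> {0..1}"
  shows "\<bar>scaled_discr n \<sigma> z\<bar> \<le> 2 ^ n"
proof -
  let ?c = "(\<Sum>t\<in>digit_vectors n. of_bool (fst (hammersley_point n \<sigma> t) < fst z
    \<and> snd (hammersley_point n \<sigma> t) < snd z)) :: real"
  have "0 \<le> ?c"
    by (intro sum_nonneg) auto
  moreover have "?c \<le> of_nat (card (digit_vectors n)) * 1"
    by (intro sum_bounded_above) auto
  then have "?c \<le> 2 ^ n"
    unfolding card_digit_vectors by simp
  moreover have z: "0 \<le> fst z * snd z" "fst z * snd z \<le> 1"
    using assms by (auto simp: mem_Times_iff mult_le_one)
  have "0 \<le> 2 ^ n * (fst z * snd z)"
    using z by simp
  moreover have "2 ^ n * (fst z * snd z) \<le> 2 ^ n"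
    using z mult_left_mono[of "fst z * snd z" 1 "2 ^ n"] by simp
  ultimately show ?thesis
    unfolding scaled_discr_eq_sum abs_le_iff by linarith
qed

text \<open>Second coordinates are multiples of 1 / 2 ^ n, so rounding \<open>y\<close> up to this
  grid changes the area but not the count.\<close>

lemma scaled_discr_eq_grid_discr:
  fixes n :: nat and x y :: real
  defines "k \<equiv> nat \<lceil>2 ^ n * y\<rceil>"
  assumes "0 \<le> y"
  shows "scaled_discr n \<sigma> (x, y) = grid_discr n \<sigma> x k + x * (real k - 2 ^ n * y)"
proof -
  have "snd (hammersley_point n \<sigma> t) < y \<longleftrightarrow> second_rank n \<sigma> t < k" for t
  proof -
    have "snd (hammersley_point n \<sigma> t) < y \<longleftrightarrow> real (second_rank n \<sigma> t) < 2 ^ n * y"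
      by (simp add: snd_hammersley_point divide_less_eq mult.commute)
    also have "\<dots> \<longleftrightarrow> int (second_rank n \<sigma> t) < \<lceil>2 ^ n * y\<rceil>"
      by (simp add: less_ceiling_iff)
    also have "\<dots> \<longleftrightarrow> second_rank n \<sigma> t < k"
      unfolding k_def by (rule zless_nat_eq_int_zless[symmetric])
    finally show ?thesis .
  qed
  then show ?thesis
    by (simp add: scaled_discr_eq_sum grid_discr_def box_count_def algebra_simps)
qed

text \<open>Rounding \<open>y\<close> up to the grid costs a factor of at most exp 1 <= 3. The
  indicators select the strip of \<open>y\<close>; strips are open below to match the ceiling, and k
  = 0 catches y = 0.\<close>

lemma exp_scaled_discr_le:
  assumes "x \<in> {0..1}" "y \<in> {0..1}" "\<bar>\<theta>\<bar> \<le> 1"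
  shows "exp (\<theta> * scaled_discr n \<sigma> (x, y)) \<le> (\<Sum>k\<le>2 ^ n. 3 * exp (\<theta> * grid_discr n \<sigma> x k)
    * indicator {(real k - 1) / 2 ^ n <.. real k / 2 ^ n} y)"
proof -
  define k where "k = nat \<lceil>2 ^ n * y\<rceil>"
  have ceil: "0 \<le> \<lceil>2 ^ n * y\<rceil>"
    using assms(2) by (intro zero_le_ceiling[THEN iffD2]) (auto intro: less_le_trans[of _ 0])
  have k: "real k - 1 < 2 ^ n * y" "2 ^ n * y \<le> real k"
    using ceil ceiling_correct[of "2 ^ n * y"] by (simp_all add: k_def)
  have "2 ^ n * y \<le> 2 ^ n * 1"
    using assms(2) by (intro mult_left_mono) auto
  then have "\<lceil>2 ^ n * y\<rceil> \<le> 2 ^ n"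
    by (simp add: ceiling_le_iff)
  then have le: "k \<le> 2 ^ n"
    by (simp add: k_def nat_le_iff)
  have "\<bar>\<theta>\<bar> * \<bar>x * (real k - 2 ^ n * y)\<bar> \<le> 1 * 1"
    using assms k by (intro mult_mono) (auto simp: abs_mult intro!: mult_le_one)
  then have "\<theta> * (x * (real k - 2 ^ n * y)) \<le> 1"
    by (simp flip: abs_mult)
  then have "exp (\<theta> * scaled_discr n \<sigma> (x, y)) \<le> exp (\<theta> * grid_discr n \<sigma> x k + 1)"
    using assms(2) unfolding k_def by (subst scaled_discr_eq_grid_discr) (auto simp: distrib_left)
  also have "\<dots> \<le> 3 * exp (\<theta> * grid_discr n \<sigma> x k)"
    using exp_le by (simp add: exp_add)
  also have "\<dots> = 3 * exp (\<theta> * grid_discr n \<sigma> x k)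
      * indicator {(real k - 1) / 2 ^ n <.. real k / 2 ^ n} y"
    using k by (simp add: field_simps)
  also have "\<dots> \<le> (\<Sum>k\<le>2 ^ n. 3 * exp (\<theta> * grid_discr n \<sigma> x k)
    * indicator {(real k - 1) / 2 ^ n <.. real k / 2 ^ n} y)"
    using le by (intro member_le_sum) auto
  finally show ?thesis .
qed

text \<open>Each strip has height 1 / 2 ^ n, which cancels the growth 2 ^ n of the integrated
  \<open>grid_mgf\<close>. The constant 12 is the rounding factor 3 times the initial bound
  4.\<close>

lemma nn_integral_exp_scaled_discr_le:
  assumes "\<forall>j\<in>{1..n}. \<sigma> j \<in> {0, 1}" "\<bar>\<theta>\<bar> \<le> 1"
  shows "(\<integral>\<^sup>+z\<in>{0..1} \<times> {0..1}. ennreal (exp (\<theta> * scaled_discr n \<sigma> z)) \<partial>lborel)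
    \<le> ennreal (12 * exp (\<theta> * (\<Sum>j=1..n. digit_sign (\<sigma> j)) / 8 + real n * \<theta>\<^sup>2 / 4))"
    (is "_ \<le> ennreal (12 * ?e)")
proof -
  let ?I = "\<lambda>k. {(real k - 1) / 2 ^ n <.. real k / 2 ^ n}"
  let ?g = "\<lambda>x k. 3 * exp (\<theta> * grid_discr n \<sigma> x k)"
  have [measurable]: "{0..1} \<times> {0..1} \<in> sets (borel :: (real \<times> real) measure)"
    by (intro borel_closed closed_Times closed_atLeastAtMost)
  have inner: "(\<integral>\<^sup>+y. ennreal (\<Sum>k\<le>2 ^ n. ?g x k * indicator (?I k) y) \<partial>lborel)
      = ennreal (3 / 2 ^ n) * ennreal (grid_mgf n \<sigma> \<theta> x)" for x
  proof -
    have "emeasure lborel (?I k) = ennreal (1 / 2 ^ n)" for k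
      by (subst emeasure_lborel_Ioc) (auto simp: divide_right_mono simp flip: diff_divide_distrib)
    then have "(\<integral>\<^sup>+y. ennreal (?g x k * indicator (?I k) y) \<partial>lborel) = ennreal (?g x k * (1 / 2 ^ n))" for k
      by (subst ennreal_mult) (auto simp: ennreal_indicator nn_integral_cmult_indicator ennreal_mult'')
    note cell = this
    have "(\<integral>\<^sup>+y. ennreal (\<Sum>k\<le>2 ^ n. ?g x k * indicator (?I k) y) \<partial>lborel)
        = (\<integral>\<^sup>+y. (\<Sum>k\<le>2 ^ n. ennreal (?g x k * indicator (?I k) y)) \<partial>lborel)"
      by (intro nn_integral_cong sum_ennreal[symmetric]) auto
    also have "\<dots> = (\<Sum>k\<le>2 ^ n. \<integral>\<^sup>+y. ennreal (?g x k * indicator (?I k) y) \<partial>lborel)"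
      by (intro nn_integral_sum) measurable
    also have "\<dots> = (\<Sum>k\<le>2 ^ n. ennreal (?g x k * (1 / 2 ^ n)))"
      by (intro sum.cong refl cell)
    also have "\<dots> = ennreal (\<Sum>k\<le>2 ^ n. ?g x k * (1 / 2 ^ n))"
      by (intro sum_ennreal) auto
    also have "(\<Sum>k\<le>2 ^ n. ?g x k * (1 / 2 ^ n)) = 3 / 2 ^ n * grid_mgf n \<sigma> \<theta> x"
      by (simp add: grid_mgf_def sum_distrib_left)
    finally show ?thesis
      by (simp only: ennreal_mult''[OF grid_mgf_nonneg])
  qed
  have "(\<integral>\<^sup>+z\<in>{0..1} \<times> {0..1}. ennreal (exp (\<theta> * scaled_discr n \<sigma> z)) \<partial>lborel)
      = (\<integral>\<^sup>+x. \<integral>\<^sup>+y. ennreal (exp (\<theta> * scaled_discr n \<sigma> (x, y))) * indicator ({0..1} \<times> {0..1}) (x, y) \<partial>lborel \<partial>lborel)"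
    unfolding lborel_prod[symmetric]
    by (intro lborel.nn_integral_fst[symmetric]) (simp add: lborel_prod)
  \<comment> \<open>The restriction of \<open>y\<close> to [0, 1] is dropped here, so that every
    strip, including k = 0 below the square, enters with its full height.\<close>
  also have "\<dots> \<le> (\<integral>\<^sup>+x. \<integral>\<^sup>+y. ennreal (\<Sum>k\<le>2 ^ n. ?g x k * indicator (?I k) y) * indicator {0..1} x \<partial>lborel \<partial>lborel)"
    using exp_scaled_discr_le[OF _ _ assms(2)]
    by (intro nn_integral_mono) (auto simp: indicator_times split: split_indicator intro!: ennreal_leI)
  also have "\<dots> = (\<integral>\<^sup>+x. ennreal (3 / 2 ^ n) * (ennreal (grid_mgf n \<sigma> \<theta> x) * indicator {0..1} x) \<partial>lborel)"
    by (intro nn_integral_cong, subst nn_integral_multc, measurable) (simp only: inner, simp only: mult.assoc)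
  also have "\<dots> = ennreal (3 / 2 ^ n) * (\<integral>\<^sup>+x\<in>{0..1}. ennreal (grid_mgf n \<sigma> \<theta> x) \<partial>lborel)"
    by (intro nn_integral_cmult) measurable
  also have "\<dots> \<le> ennreal (3 / 2 ^ n) * ennreal (4 * 2 ^ n * ?e)"
    by (intro mult_left_mono nn_integral_grid_mgf_le assms) simp
  also have "\<dots> = ennreal (12 * ?e)"
    by (subst ennreal_mult[symmetric]) auto
  finally show ?thesis .
qed

subsection \<open>The mean of the discrepancy\<close>

lemma sum_digit_sign:
  "(\<Sum>j=1..n. digit_sign (\<sigma> j)) = 2 * real (num_zeros n \<sigma>) - real n"
proof -
  have "(\<Sum>j=1..n. digit_sign (\<sigma> j)) = (\<Sum>j=1..n. 2 * of_bool (\<sigma> j = 0) - 1)"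
    by (intro sum.cong) (auto simp: digit_sign_def)
  also have "\<dots> = 2 * real (num_zeros n \<sigma>) - real n"
    by (simp add: sum_subtractf num_zeros_def sum_of_bool_eq Int_def flip: sum_distrib_left)
  finally show ?thesis .
qed

section \<open>Integrals over the unit square\<close>

lemma borel_unit_square [measurable]: "{0..1} \<times> {0..1} \<in> sets (borel :: (real \<times> real) measure)"
  by (intro borel_closed closed_Times closed_atLeastAtMost)

lemma emeasure_lborel_Times:
  fixes A B :: "real set"
  assumes "A \<in> sets borel" "B \<in> sets borel"
  shows "emeasure lborel (A \<times> B) = emeasure lborel A * emeasure lborel B"
  unfolding lborel_prod[symmetric] using assms by (intro lborel.emeasure_pair_measure_Times) auto

lemma set_integrable_unit_square_bounded:
  fixes f :: "real \<times> real \<Rightarrow> real"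
  assumes [measurable]: "f \<in> borel_measurable borel"
    and "\<And>z. z \<in> {0..1} \<times> {0..1} \<Longrightarrow> \<bar>f z\<bar> \<le> B"
  shows "set_integrable lborel ({0..1} \<times> {0..1}) f"
  unfolding set_integrable_def using assms(2)
  by (intro integrableI_bounded_set_indicator[where B = B]) (auto simp: emeasure_lborel_Times)

lemma integral_unit_square_mult:
  "(LINT z:{0..1} \<times> {0..1}|lborel. fst z * snd z) = (1 / 4 :: real)"
proof -
  let ?f = "\<lambda>x. x * indicator {0..1} x :: real"
  have half: "(\<integral>x. ?f x \<partial>lborel) = 1 / 2"
    using integral_power[of 0 1 1] by simp
  have "set_integrable lborel ({0..1} \<times> {0..1}) (\<lambda>z::real \<times> real. fst z * snd z)"
    by (intro set_integrable_unit_square_bounded[where B = 1] borel_measurable_continuous_onI continuous_intros)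
      (auto simp: abs_mult intro!: mult_le_one)
  moreover have "(\<lambda>z :: real \<times> real. indicator ({0..1} \<times> {0..1}) z *\<^sub>R (fst z * snd z))
      = (\<lambda>z. ?f (fst z) * ?f (snd z))"
    by (rule ext) (auto simp: indicator_def)
  ultimately have "integrable (lborel \<Otimes>\<^sub>M lborel) (\<lambda>z. ?f (fst z) * ?f (snd z))"
    and "(LINT z:{0..1} \<times> {0..1}|lborel. fst z * snd z) = (\<integral>z. ?f (fst z) * ?f (snd z) \<partial>(lborel \<Otimes>\<^sub>M lborel))"
    by (simp_all only: set_integrable_def set_lebesgue_integral_def lborel_prod)
  then have "(LINT z:{0..1} \<times> {0..1}|lborel. fst z * snd z)
      = (\<integral>x. (\<integral>y. ?f x * ?f y \<partial>lborel) \<partial>lborel)"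
    using lborel_pair.integral_fst'[of "\<lambda>z. ?f (fst z) * ?f (snd z)"] by simp
  also have "\<dots> = 1 / 4"
    by (simp only: integral_mult_right_zero integral_mult_left_zero half)
  finally show ?thesis .
qed

lemma integral_unit_square_quadrant:
  fixes a b :: real
  assumes "0 \<le> a" "a < 1" "0 \<le> b" "b < 1"
  shows "(LINT z:{0..1} \<times> {0..1}|lborel. of_bool (a < fst z \<and> b < snd z)) = (1 - a) * (1 - b)"
proof -
  have "(LINT z:{0..1} \<times> {0..1}|lborel. of_bool (a < fst z \<and> b < snd z))
      = (\<integral>z. indicator ({a<..1} \<times> {b<..1}) z \<partial>(lborel :: (real \<times> real) measure))"
    unfolding set_lebesgue_integral_def using assms
    by (intro Bochner_Integration.integral_cong) (auto simp: indicator_def)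
  also have "\<dots> = measure lborel ({a<..1} \<times> {b<..1})"
    by simp
  also have "\<dots> = (1 - a) * (1 - b)"
    using assms by (simp add: measure_def emeasure_lborel_Times flip: ennreal_mult)
  finally show ?thesis .
qed

section \<open>Sums of the coordinates and of their products\<close>

lemma sum_fst_hammersley_point:
  "(\<Sum>t\<in>digit_vectors n. fst (hammersley_point n \<sigma> t)) = (2 ^ n - 1) / 2"
proof (induction n)
  case 0
  then show ?case by (simp add: hammersley_point_def)
next
  case (Suc n)
  then show ?case
    unfolding sum_digit_vectors_Suc fst_hammersley_point_Suc sum_divide_distrib[symmetric] sum.distrib
      sum_constant card_digit_vectors by (simp add: field_simps)
qed

lemma sum_shifted_digits:
  "real (s mod 2) + real ((1 + s) mod 2) = 1"
  by (cases "even s") (auto simp: even_iff_mod_2_eq_zero odd_iff_mod_2_eq_one mod_Suc)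

lemma sum_snd_hammersley_point:
  "(\<Sum>t\<in>digit_vectors n. snd (hammersley_point n \<sigma> t)) = (2 ^ n - 1) / 2"
proof (induction n)
  case 0
  then show ?case by (simp add: hammersley_point_def)
next
  case (Suc n)
  let ?s = "\<sigma> (Suc n)"
  have "(\<Sum>t\<in>digit_vectors (Suc n). snd (hammersley_point (Suc n) \<sigma> t))
      = 2 * ((2 ^ n - 1) / 2) + 2 ^ n * ((real (?s mod 2) + real ((1 + ?s) mod 2)) / 2 ^ Suc n)"
    unfolding sum_digit_vectors_Suc snd_hammersley_point_Suc sum.distrib Suc.IH
      sum_constant card_digit_vectors by (simp add: add_divide_distrib distrib_left)
  then show ?case
    unfolding sum_shifted_digits by (simp add: field_simps)
qed

text \<open>Here the shift becomes visible: the new digit adds 1 / 2 to the first coordinate and,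
  through \<open>d1\<close>, to the second one in the same points exactly when its shift is 0. This
  correlation produces the signed 1 / 8.\<close>

lemma sum_fst_snd_hammersley_point:
  assumes "\<forall>j\<in>{1..n}. \<sigma> j \<in> {0, 1}"
  shows "(\<Sum>t\<in>digit_vectors n. fst (hammersley_point n \<sigma> t) * snd (hammersley_point n \<sigma> t))
    = 2 ^ n / 4 - 1 / 2 + (\<Sum>j=1..n. digit_sign (\<sigma> j)) / 8 + 1 / (4 * 2 ^ n)"
  using assms
proof (induction n)
  case 0
  then show ?case by (simp add: hammersley_point_def)
next
  case (Suc n)
  let ?s = "\<sigma> (Suc n)"
  let ?X = "\<lambda>t. fst (hammersley_point n \<sigma> t)" and ?Y = "\<lambda>t. snd (hammersley_point n \<sigma> t)"
  define d0 d1 where "d0 = real (?s mod 2) / 2 ^ Suc n" and "d1 = real ((1 + ?s) mod 2) / 2 ^ Suc n"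
  have s: "?s \<in> {0, 1}"
    using Suc.prems by auto
  have d: "d1 = (1 + digit_sign ?s) / 2 / 2 ^ Suc n" "d0 + d1 = 1 / 2 ^ Suc n"
    using s by (auto simp: d0_def d1_def digit_sign_def)
  have "(\<Sum>t\<in>digit_vectors (Suc n). fst (hammersley_point (Suc n) \<sigma> t) * snd (hammersley_point (Suc n) \<sigma> t))
      = (\<Sum>t\<in>digit_vectors n. ?X t / 2 * (?Y t + d0)) + (\<Sum>t\<in>digit_vectors n. (1 + ?X t) / 2 * (?Y t + d1))"
    unfolding sum_digit_vectors_Suc fst_hammersley_point_Suc snd_hammersley_point_Suc
    by (simp add: d0_def d1_def)
  also have "\<dots> = (\<Sum>t\<in>digit_vectors n. ?X t * ?Y t + (d0 + d1) / 2 * ?X t + 1 / 2 * ?Y t + d1 / 2)"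
    unfolding sum.distrib[symmetric] by (intro sum.cong) (auto simp: field_simps)
  also have "\<dots> = (\<Sum>t\<in>digit_vectors n. ?X t * ?Y t) + (d0 + d1) / 2 * ((2 ^ n - 1) / 2)
      + 1 / 2 * ((2 ^ n - 1) / 2) + 2 ^ n * (d1 / 2)"
    unfolding sum.distrib sum_distrib_left[symmetric] sum_fst_hammersley_point sum_snd_hammersley_point
      sum_constant card_digit_vectors by simp
  also have "(\<Sum>t\<in>digit_vectors n. ?X t * ?Y t)
      = 2 ^ n / 4 - 1 / 2 + (\<Sum>j=1..n. digit_sign (\<sigma> j)) / 8 + 1 / (4 * 2 ^ n)"
    using Suc.prems by (intro Suc.IH) auto
  also have "2 ^ n / 4 - 1 / 2 + (\<Sum>j=1..n. digit_sign (\<sigma> j)) / 8 + 1 / (4 * 2 ^ n)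
      + (d0 + d1) / 2 * ((2 ^ n - 1) / 2) + 1 / 2 * ((2 ^ n - 1) / 2) + 2 ^ n * (d1 / 2)
    = 2 ^ Suc n / 4 - 1 / 2 + (\<Sum>j=1..Suc n. digit_sign (\<sigma> j)) / 8 + 1 / (4 * 2 ^ Suc n)"
    unfolding d(2) unfolding d(1) by (simp add: field_simps)
  finally show ?case .
qed

text \<open>A point (X, Y) lies in the box of \<open>z\<close> for a set of \<open>z\<close> of area
  (1 - X) * (1 - Y). Expanding the product reduces the mean to the three coordinate sums.\<close>

lemma integral_scaled_discr:
  assumes "\<forall>j\<in>{1..n}. \<sigma> j \<in> {0, 1}"
  shows "(LINT z:{0..1} \<times> {0..1}|lborel. scaled_discr n \<sigma> z)
    = (\<Sum>j=1..n. digit_sign (\<sigma> j)) / 8 + 1 / 2 + 1 / (4 * 2 ^ n)"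
proof -
  let ?X = "\<lambda>t. fst (hammersley_point n \<sigma> t)" and ?Y = "\<lambda>t. snd (hammersley_point n \<sigma> t)"
  let ?S = "{0..1} \<times> {0..1} :: (real \<times> real) set"
  have [measurable]: "fst \<in> borel_measurable (borel :: (real \<times> real) measure)"
    "snd \<in> borel_measurable (borel :: (real \<times> real) measure)"
    by (intro borel_measurable_continuous_onI continuous_intros)+
  have i1: "set_integrable lborel ?S (\<lambda>z. of_bool (?X t < fst z \<and> ?Y t < snd z) :: real)" for t
    unfolding of_bool_def by (intro set_integrable_unit_square_bounded[where B = 1]) auto
  have i2: "set_integrable lborel ?S (\<lambda>z. 2 ^ n * (fst z * snd z))"
    by (intro set_integrable_unit_square_bounded[where B = "2 ^ n"] borel_measurable_continuous_onI continuous_intros)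
      (auto simp: abs_mult intro!: mult_le_one)
  have "(LINT z:?S|lborel. scaled_discr n \<sigma> z)
      = (LINT z:?S|lborel. \<Sum>t\<in>digit_vectors n. of_bool (?X t < fst z \<and> ?Y t < snd z))
        - (LINT z:?S|lborel. 2 ^ n * (fst z * snd z))"
    unfolding scaled_discr_eq_sum
    by (intro set_integral_diff(2) i2) (use i1 in \<open>auto simp: set_integrable_def sum_distrib_left\<close>)
  also have "\<dots> = (\<Sum>t\<in>digit_vectors n. LINT z:?S|lborel. of_bool (?X t < fst z \<and> ?Y t < snd z)) - 2 ^ n / 4"
  proof -
    have "(LINT z:?S|lborel. \<Sum>t\<in>digit_vectors n. of_bool (?X t < fst z \<and> ?Y t < snd z) :: real)
      = (\<Sum>t\<in>digit_vectors n. LINT z:?S|lborel. of_bool (?X t < fst z \<and> ?Y t < snd z))"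
      unfolding set_lebesgue_integral_def scaleR_sum_right
      by (intro Bochner_Integration.integral_sum i1[unfolded set_integrable_def])
    then show ?thesis
      by (simp add: integral_unit_square_mult)
  qed
  also have "(\<Sum>t\<in>digit_vectors n. LINT z:?S|lborel. of_bool (?X t < fst z \<and> ?Y t < snd z))
      = (\<Sum>t\<in>digit_vectors n. (1 - ?X t) * (1 - ?Y t))"
    by (intro sum.cong integral_unit_square_quadrant fst_hammersley_point_nonneg snd_hammersley_point_nonneg
        fst_hammersley_point_less_1 snd_hammersley_point_less_1) auto
  also have "\<dots> = (\<Sum>t\<in>digit_vectors n. 1 - ?X t - ?Y t + ?X t * ?Y t)"
    by (intro sum.cong) (auto simp: algebra_simps)
  also have "\<dots> = 2 ^ n - (2 ^ n - 1) / 2 - (2 ^ n - 1) / 2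
      + (2 ^ n / 4 - 1 / 2 + (\<Sum>j=1..n. digit_sign (\<sigma> j)) / 8 + 1 / (4 * 2 ^ n))"
    unfolding sum.distrib sum_subtractf sum_fst_hammersley_point sum_snd_hammersley_point
      sum_fst_snd_hammersley_point[OF assms] sum_constant card_digit_vectors by simp
  finally show ?thesis
    by (simp add: field_simps)
qed

subsection \<open>Moments\<close>

lemma Lp_discrepancy_shifted_hammersley:
  assumes "0 < p"
  shows "2 ^ n * Lp_discrepancy p (mset_set (shifted_hammersley n \<sigma>))
    = (LINT z:{0..1} \<times> {0..1}|lborel. \<bar>scaled_discr n \<sigma> z\<bar> powr p) powr (1 / p)"
proof -
  let ?P = "mset_set (shifted_hammersley n \<sigma>)"
  have "(LINT z:{0..1} \<times> {0..1}|lborel. \<bar>scaled_discr n \<sigma> z\<bar> powr p)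
      = (LINT z:{0..1} \<times> {0..1}|lborel. (2 ^ n) powr p * \<bar>local_discrepancy ?P z\<bar> powr p)"
    by (simp add: scaled_discr_def abs_mult powr_mult)
  also have "\<dots> = (2 ^ n) powr p * (LINT z:{0..1} \<times> {0..1}|lborel. \<bar>local_discrepancy ?P z\<bar> powr p)"
    by (rule set_integral_mult_right)
  also have "\<dots> powr (1 / p)
      = ((2 ^ n) powr p) powr (1 / p) * (LINT z:{0..1} \<times> {0..1}|lborel. \<bar>local_discrepancy ?P z\<bar> powr p) powr (1 / p)"
    by (rule powr_mult)
  finally show ?thesis
    using assms by (simp add: Lp_discrepancy_def powr_powr)
qed

text \<open>The inequality u / p <= exp (u / p), raised to the power \<open>p\<close>. It converts
  exponential moments into moments of any real order.\<close>

lemma powr_le_exp: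
  fixes u p :: real
  assumes "0 \<le> u" "0 < p"
  shows "u powr p \<le> p powr p * exp u"
proof -
  have "u / p \<le> exp (u / p)"
    using exp_ge_add_one_self[of "u / p"] by linarith
  then have "(u / p) powr p \<le> exp (u / p) powr p"
    using assms by (intro powr_mono2) auto
  also have "\<dots> = exp u"
    using assms by (simp add: powr_def)
  finally show ?thesis
    using assms by (simp add: powr_divide field_simps)
qed

text \<open>The choice of 1 / sqrt n and its negative for \<open>\<theta>\<close> balances the
  exponent: the variance term becomes 1 / 4 and the drift is at most C / 8. Using both signs
  controls the absolute value and doubles 12 to 24.\<close>

lemma integral_scaled_discr_powr_le:
  assumes digits: "\<forall>j\<in>{1..n}. \<sigma> j \<in> {0, 1}" and "1 \<le> n" "0 < p"
    and "\<bar>\<Sum>j=1..n. digit_sign (\<sigma> j)\<bar> \<le> C * sqrt (real n)"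
  shows "(LINT z:{0..1} \<times> {0..1}|lborel. \<bar>scaled_discr n \<sigma> z\<bar> powr p)
    \<le> sqrt (real n) powr p * (p powr p * (24 * exp (C / 8 + 1 / 4)))"
proof -
  let ?S = "{0..1} \<times> {0..1} :: (real \<times> real) set"
  let ?e = "\<lambda>\<theta> z. exp (\<theta> * scaled_discr n \<sigma> z)"
  define r where "r = sqrt (real n)"
  define c where "c = r powr p * p powr p"
  have r: "1 \<le> r" "r\<^sup>2 = real n"
    using assms(2) by (simp_all add: r_def)
  have pt: "\<bar>scaled_discr n \<sigma> z\<bar> powr p \<le> c * (?e (1 / r) z + ?e (- 1 / r) z)" for z
  proof -
    let ?v = "scaled_discr n \<sigma> z"
    have "\<bar>?v\<bar> powr p = r powr p * (\<bar>?v\<bar> / r) powr p"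
      using r(1) by (simp flip: powr_mult)
    also have "\<dots> \<le> r powr p * (p powr p * exp (\<bar>?v\<bar> / r))"
      using r(1) assms(3) by (intro mult_left_mono powr_le_exp) auto
    also have "exp (\<bar>?v\<bar> / r) \<le> ?e (1 / r) z + ?e (- 1 / r) z"
      by (cases "0 \<le> ?v") auto
    finally show ?thesis
      by (simp add: c_def mult_left_mono mult.assoc)
  qed
  have e: "(\<integral>\<^sup>+z\<in>?S. ennreal (?e \<theta> z) \<partial>lborel) \<le> ennreal (12 * exp (C / 8 + 1 / 4))"
    if "\<theta> \<in> {1 / r, - 1 / r}" for \<theta>
  proof -
    have \<theta>: "\<bar>\<theta>\<bar> = 1 / r"
      using that r(1) by auto
    have "\<theta> * (\<Sum>j=1..n. digit_sign (\<sigma> j)) \<le> \<bar>\<theta>\<bar> * \<bar>\<Sum>j=1..n. digit_sign (\<sigma> j)\<bar>"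
      by (metis abs_ge_self abs_mult)
    also have "\<dots> \<le> 1 / r * (C * r)"
      unfolding \<theta> using assms(4) r(1) by (intro mult_left_mono) (auto simp: r_def)
    also have "\<dots> = C"
      using r(1) by simp
    finally have *: "\<theta> * (\<Sum>j=1..n. digit_sign (\<sigma> j)) \<le> C" .
    have "\<theta>\<^sup>2 = 1 / real n"
      using \<theta> r(2) by (metis power2_abs power_one_over)
    then have "real n * \<theta>\<^sup>2 = 1"
      using assms(2) by simp
    moreover have "\<bar>\<theta>\<bar> \<le> 1"
      using r(1) unfolding \<theta> by simp
    ultimately have "(\<integral>\<^sup>+z\<in>?S. ennreal (?e \<theta> z) \<partial>lborel)
        \<le> ennreal (12 * exp (\<theta> * (\<Sum>j=1..n. digit_sign (\<sigma> j)) / 8 + 1 / 4))"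
      using nn_integral_exp_scaled_discr_le[OF digits, of \<theta>] by simp
    also have "\<dots> \<le> ennreal (12 * exp (C / 8 + 1 / 4))"
      using * by (intro ennreal_leI) simp
    finally show ?thesis .
  qed
  have "(\<integral>\<^sup>+z. ennreal (indicator ?S z *\<^sub>R \<bar>scaled_discr n \<sigma> z\<bar> powr p) \<partial>lborel)
      \<le> (\<integral>\<^sup>+z. ennreal c * (ennreal (?e (1 / r) z) * indicator ?S z + ennreal (?e (- 1 / r) z) * indicator ?S z) \<partial>lborel)"
    using pt by (intro nn_integral_mono)
      (auto simp: indicator_def c_def simp flip: ennreal_plus ennreal_mult intro!: ennreal_leI)
  also have "\<dots> = ennreal c * ((\<integral>\<^sup>+z\<in>?S. ennreal (?e (1 / r) z) \<partial>lborel) + (\<integral>\<^sup>+z\<in>?S. ennreal (?e (- 1 / r) z) \<partial>lborel))"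
    by (simp add: nn_integral_cmult nn_integral_add)
  also have "\<dots> \<le> ennreal c * (ennreal (12 * exp (C / 8 + 1 / 4)) + ennreal (12 * exp (C / 8 + 1 / 4)))"
    by (intro mult_left_mono add_mono e) auto
  also have "\<dots> = ennreal (c * (24 * exp (C / 8 + 1 / 4)))"
    by (simp add: c_def flip: ennreal_plus ennreal_mult)
  finally show ?thesis
    unfolding set_lebesgue_integral_def
    by (intro integral_real_bounded) (simp_all add: c_def r_def mult.assoc)
qed

text \<open>Comparison of \<open>L\<^sub>1\<close> and \<open>L\<^sub>p\<close> norms with a wasteful constant, in place of Hoelder's inequality.\<close>
lemma le_add_powr:
  fixes a d p :: real
  assumes "0 < a" "0 \<le> d" "1 \<le> p"
  shows "d \<le> a + a / a powr p * d powr p"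
proof (cases "d \<le> a")
  case True
  then show ?thesis
    using assms by (simp add: add_increasing2)
next
  case False
  then have "d / a \<le> (d / a) powr p"
    using assms powr_mono[of 1 p "d / a"] by simp
  then have "d \<le> a / a powr p * d powr p"
    using assms by (simp add: powr_divide field_simps)
  then show ?thesis
    using assms(1) by linarith
qed

text \<open>The mean is at most the L1 norm, which is at most 2 * a. Removing the offset, at most 3
  / 4, and multiplying by 8 gives 16 * a + 6.\<close>

lemma abs_sum_digit_sign_le:
  assumes digits: "\<forall>j\<in>{1..n}. \<sigma> j \<in> {0, 1}" and "1 \<le> p" "0 < a"
    and le: "(LINT z:{0..1} \<times> {0..1}|lborel. \<bar>scaled_discr n \<sigma> z\<bar> powr p) powr (1 / p) \<le> a"
  shows "\<bar>\<Sum>j=1..n. digit_sign (\<sigma> j)\<bar> \<le> 16 * a + 6"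
proof -
  let ?S = "{0..1} \<times> {0..1} :: (real \<times> real) set"
  let ?J = "LINT z:?S|lborel. \<bar>scaled_discr n \<sigma> z\<bar> powr p"
  have J0: "0 \<le> ?J"
    by (auto simp: set_lebesgue_integral_def intro!: integral_nonneg_AE)
  have "?J = (?J powr (1 / p)) powr p"
    using J0 assms(2) by (simp add: powr_powr)
  also have "\<dots> \<le> a powr p"
    using le assms(2) by (intro powr_mono2) auto
  finally have J: "?J \<le> a powr p" .
  have i1: "set_integrable lborel ?S (\<lambda>z. \<bar>scaled_discr n \<sigma> z\<bar>)"
    using abs_scaled_discr_le by (intro set_integrable_unit_square_bounded[where B = "2 ^ n"]) auto
  have i2: "set_integrable lborel ?S (\<lambda>z. a / a powr p * \<bar>scaled_discr n \<sigma> z\<bar> powr p)"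
    using abs_scaled_discr_le assms(2)
    by (intro set_integrable_mult_right set_integrable_unit_square_bounded[where B = "(2 ^ n) powr p"])
      (auto intro!: powr_mono2)
  have i3: "set_integrable lborel ?S (\<lambda>z. a)"
    by (intro set_integrable_unit_square_bounded[where B = "\<bar>a\<bar>"]) auto
  have "measure lborel ?S = 1"
    by (simp add: measure_def emeasure_lborel_Times)
  then have a: "(LINT z:?S|lborel. a) = a"
    by (simp add: set_lebesgue_integral_def)
  have "\<bar>LINT z:?S|lborel. scaled_discr n \<sigma> z\<bar> \<le> (LINT z:?S|lborel. \<bar>scaled_discr n \<sigma> z\<bar>)"
    unfolding set_lebesgue_integral_def
    using integral_norm_bound[of lborel "\<lambda>z. indicator ?S z *\<^sub>R scaled_discr n \<sigma> z"] by (simp add: abs_mult)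
  also have "\<dots> \<le> (LINT z:?S|lborel. a + a / a powr p * \<bar>scaled_discr n \<sigma> z\<bar> powr p)"
    using assms(2,3) by (intro set_integral_mono i1 set_integral_add(1) i2 i3 le_add_powr) auto
  also have "\<dots> = a + a / a powr p * ?J"
    using a by (subst set_integral_add(2)[OF i3 i2]) (simp only: set_integral_mult_right)
  also have "\<dots> \<le> a + a / a powr p * a powr p"
    using assms(3) J by (intro add_left_mono mult_left_mono) auto
  also have "\<dots> = 2 * a"
    using assms(3) by simp
  finally have "\<bar>(\<Sum>j=1..n. digit_sign (\<sigma> j)) / 8 + 1 / 2 + 1 / (4 * 2 ^ n)\<bar> \<le> 2 * a"
    unfolding integral_scaled_discr[OF digits] .
  moreover have "0 \<le> 1 / (4 * 2 ^ n :: real)" "1 / (4 * 2 ^ n :: real) \<le> 1 / 4"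
    by (simp_all add: field_simps)
  ultimately show ?thesis
    by linarith
qed

theorem theorem1:
  fixes p :: real and \<sigma> :: "nat \<Rightarrow> nat \<Rightarrow> nat"
  assumes "1 < p"
    and "\<And>n j. 1 \<le> n \<Longrightarrow> j \<in> {1..n} \<Longrightarrow> \<sigma> n j \<in> {0, 1}"
  shows "(\<exists>C>0. \<forall>n\<ge>1. Lp_discrepancy p (mset_set (shifted_hammersley n (\<sigma> n)))
              \<le> C * (sqrt (ln (2 ^ n)) / 2 ^ n))
     \<longleftrightarrow> (\<exists>C'>0. \<forall>n\<ge>1. \<bar>2 * real (num_zeros n (\<sigma> n)) - real n\<bar> \<le> C' * sqrt (real n))"
proof -
  let ?J = "\<lambda>n. LINT z:{0..1} \<times> {0..1}|lborel. \<bar>scaled_discr n (\<sigma> n) z\<bar> powr p"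
  have digits: "\<forall>j\<in>{1..n}. \<sigma> n j \<in> {0, 1}" if "1 \<le> n" for n
    using assms(2) that by blast
  \<comment> \<open>Multiplying by 2 ^ n turns the discrepancy bound into one of order sqrt n for
    the scaled discrepancy.\<close>
  have iff: "Lp_discrepancy p (mset_set (shifted_hammersley n (\<sigma> n))) \<le> C * (sqrt (ln (2 ^ n)) / 2 ^ n)
      \<longleftrightarrow> ?J n powr (1 / p) \<le> C * sqrt (ln 2) * sqrt (real n)" for n C
  proof -
    have "?J n powr (1 / p) = 2 ^ n * Lp_discrepancy p (mset_set (shifted_hammersley n (\<sigma> n)))"
      using assms(1) by (simp add: Lp_discrepancy_shifted_hammersley)
    moreover have "sqrt (ln (2 ^ n)) = sqrt (ln 2) * sqrt (real n)"
      by (simp add: ln_realpow real_sqrt_mult)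
    ultimately show ?thesis
      by (simp add: field_simps)
  qed
  show ?thesis
    unfolding iff
  proof (intro iffI; elim exE conjE)
    fix C :: real
    assume C: "0 < C" "\<forall>n\<ge>1. ?J n powr (1 / p) \<le> C * sqrt (ln 2) * sqrt (real n)"
    have "\<bar>2 * real (num_zeros n (\<sigma> n)) - real n\<bar> \<le> (16 * C * sqrt (ln 2) + 6) * sqrt (real n)"
      if "1 \<le> n" for n
    proof -
      have "\<bar>\<Sum>j=1..n. digit_sign (\<sigma> n j)\<bar> \<le> 16 * (C * sqrt (ln 2) * sqrt (real n)) + 6"
        using C assms(1) that by (intro abs_sum_digit_sign_le[OF digits, where p = p]) auto
      \<comment> \<open>As n >= 1, the additive constant is absorbed by sqrt n.\<close>
      also have "\<dots> \<le> 16 * (C * sqrt (ln 2) * sqrt (real n)) + 6 * sqrt (real n)"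
        using that by simp
      finally show ?thesis
        unfolding sum_digit_sign by (simp add: algebra_simps)
    qed
    moreover have "0 < 16 * C * sqrt (ln 2) + 6"
      using C(1) by (intro add_nonneg_pos mult_nonneg_nonneg) auto
    ultimately show "\<exists>C'>0. \<forall>n\<ge>1. \<bar>2 * real (num_zeros n (\<sigma> n)) - real n\<bar> \<le> C' * sqrt (real n)"
      by blast
  next
    fix C :: real
    assume C: "0 < C" "\<forall>n\<ge>1. \<bar>2 * real (num_zeros n (\<sigma> n)) - real n\<bar> \<le> C * sqrt (real n)"
    define K where "K = p powr p * (24 * exp (C / 8 + 1 / 4))"
    have K: "0 < K"
      using assms(1) by (simp add: K_def)
    \<comment> \<open>The witness carries the divisor sqrt (ln 2) to cancel the factor coming from
      the logarithm of 2 ^ n.\<close>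
    have "?J n powr (1 / p) \<le> K powr (1 / p) / sqrt (ln 2) * sqrt (ln 2) * sqrt (real n)" if "1 \<le> n" for n
    proof -
      have "?J n \<le> sqrt (real n) powr p * K"
        unfolding K_def using C(2) assms(1) that
        by (intro integral_scaled_discr_powr_le[OF digits]) (auto simp: sum_digit_sign simp del: One_nat_def)
      then have "?J n powr (1 / p) \<le> (sqrt (real n) powr p * K) powr (1 / p)"
        using assms(1)
        by (intro powr_mono2) (auto simp: set_lebesgue_integral_def intro!: integral_nonneg_AE)
      also have "\<dots> = sqrt (real n) * K powr (1 / p)"
        using assms(1) K by (simp add: powr_mult powr_powr)
      finally show ?thesis
        by (simp add: mult.commute)
    qed
    moreover have "0 < K powr (1 / p) / sqrt (ln 2)"
      using K by simp
    ultimately show "\<exists>C>0. \<forall>n\<ge>1. ?J n powr (1 / p) \<le> C * sqrt (ln 2) * sqrt (real n)"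
      by blast
  qed
qed

end
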